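(* Let $X$ be a compact metric space and let $T:X\to X$ be a continuous map. Suppose that the set $\mathcal{M}_p$ of $T$-periodic measures is dense in the space $\mathcal{M}(T)$ of $T$-invariant Borel probability measures on $X$, endowed with the weak topology. Then $$HD=\{\mu\in\mathcal{M}(T)\mid \dim_H^+(\mu)=0\}$$ is a residual subset of $\mathcal{M}(T)$.
   Context: $\mathcal{M}(T)$ carries the weak topology ($\mu_\alpha\to\mu$ iff $\int f\,d\mu_\alpha\to\int f\,d\mu$ for every bounded continuous $f:X\to\mathbb{R}$). $\mathcal{M}_p$ is the set of measures of the form $\mu_x=\frac{1}{k_x}\sum_{i=0}^{k_x-1}\delta_{T^i x}$, where $x\in X$ is a $T$-periodic point of period $k_x$. The upper Hausdorff dimension of a Borel probability measure $\mu$ on $X$ is $\dim_H^+(\mu)=\inf\{\dim_H(E)\mid E\subset X \text{ Borel},\ \mu(X\setminus E)=0\}$, where $\dim_H(E)$ is the Hausdorff dimension of $E$. A subset of a topological space is residual if it contains a countable intersection of open dense sets. *)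

theory Defs
  imports "HOL-Probability.Probability"
begin

definition invariant_prob_measures :: "('a::topological_space \<Rightarrow> 'a) \<Rightarrow> 'a measure set" where
  "invariant_prob_measures T =
     {\<mu>. prob_space \<mu> \<and> sets \<mu> = sets borel \<and> distr \<mu> borel T = \<mu>}"

text \<open>
  The coarsest topology on \<open>M\<close> making every map \<open>\<mu> \<mapsto> \<integral> f d\<mu>\<close>, with \<open>f\<close> bounded and continuous,
  continuous. Its convergent nets are characterised in \<open>limitin_weak_topology_on\<close> below.
\<close>

definition weak_topology_on :: "'a::topological_space measure set \<Rightarrow> 'a measure topology" where
  "weak_topology_on M =
     topology_generated_by
       {{\<mu> \<in> M. integral\<^sup>L \<mu> f \<in> U} | (f :: 'a \<Rightarrow> real) U.
          continuous_on UNIV f \<and> bounded (range f) \<and> open U}"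

lemma topspace_weak_topology_on [simp]: "topspace (weak_topology_on M) = M"
proof -
  have "M \<in> {{\<mu> \<in> M. integral\<^sup>L \<mu> f \<in> U} | (f :: 'a \<Rightarrow> real) U.
          continuous_on UNIV f \<and> bounded (range f) \<and> open U}"
    by (rule CollectI, rule exI[of _ "\<lambda>_. 0"], rule exI[of _ UNIV]) auto
  then show ?thesis
    unfolding weak_topology_on_def topology_generated_by_topspace by blast
qed

lemma limitin_weak_topology_on:
  "limitin (weak_topology_on M) \<mu>s \<mu> F \<longleftrightarrow>
     \<mu> \<in> M \<and> (\<forall>\<^sub>F i in F. \<mu>s i \<in> M) \<and>
     (\<forall>f :: 'a::topological_space \<Rightarrow> real. continuous_on UNIV f \<and> bounded (range f) \<longrightarrow>
        ((\<lambda>i. integral\<^sup>L (\<mu>s i) f) \<longlongrightarrow> integral\<^sup>L \<mu> f) F)"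
  (is "?L \<longleftrightarrow> ?R")
proof
  assume L: ?L
  have "\<forall>\<^sub>F i in F. \<mu>s i \<in> M"
    using L openin_topspace[of "weak_topology_on M"] by (auto simp: limitin_def)
  moreover have "((\<lambda>i. integral\<^sup>L (\<mu>s i) f) \<longlongrightarrow> integral\<^sup>L \<mu> f) F"
    if f: "continuous_on UNIV f" "bounded (range f)" for f :: "'a \<Rightarrow> real"
  proof (rule topological_tendstoI)
    fix U :: "real set" assume U: "open U" "integral\<^sup>L \<mu> f \<in> U"
    have "openin (weak_topology_on M) {\<mu> \<in> M. integral\<^sup>L \<mu> f \<in> U}"
      unfolding weak_topology_on_def by (rule topology_generated_by_Basis) (use f U in blast)
    then have "\<forall>\<^sub>F i in F. \<mu>s i \<in> {\<mu> \<in> M. integral\<^sup>L \<mu> f \<in> U}"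
      using L U by (auto simp: limitin_def)
    then show "\<forall>\<^sub>F i in F. integral\<^sup>L (\<mu>s i) f \<in> U"
      by (rule eventually_mono) simp
  qed
  ultimately show ?R using L limitin_topspace[OF L] by auto
next
  assume R: ?R
  have "\<forall>\<^sub>F i in F. \<mu>s i \<in> V" if "openin (weak_topology_on M) V" "\<mu> \<in> V" for V
  proof -
    from that(1) have "generate_topology_on
       {{\<mu> \<in> M. integral\<^sup>L \<mu> f \<in> U} | (f :: 'a \<Rightarrow> real) U.
          continuous_on UNIV f \<and> bounded (range f) \<and> open U} V"
      unfolding weak_topology_on_def openin_topology_generated_by_iff .
    then show ?thesis using that(2)
    proof induction
      case (Int a b)
      then show ?case by (auto intro: eventually_conj)
    next
      case (UN K)
      then obtain k where "k \<in> K" "\<mu> \<in> k" by blast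
      with UN have "\<forall>\<^sub>F i in F. \<mu>s i \<in> k" by blast
      then show ?case by (rule eventually_mono) (use \<open>k \<in> K\<close> in blast)
    next
      case (Basis s)
      then obtain f :: "'a \<Rightarrow> real" and U where s: "s = {\<mu> \<in> M. integral\<^sup>L \<mu> f \<in> U}"
        and f: "continuous_on UNIV f" "bounded (range f)" and U: "open U" by blast
      have "\<forall>\<^sub>F i in F. integral\<^sup>L (\<mu>s i) f \<in> U"
        using R f Basis U s by (auto dest!: topological_tendstoD)
      with R have "\<forall>\<^sub>F i in F. \<mu>s i \<in> M \<and> integral\<^sup>L (\<mu>s i) f \<in> U"
        by (auto intro: eventually_conj)
      then show ?case using s by simp
    qed simp
  qed
  with R show ?L by (auto simp: limitin_def)
qed

definition periodic_point :: "('a \<Rightarrow> 'a) \<Rightarrow> 'a \<Rightarrow> bool" where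
  "periodic_point T x \<longleftrightarrow> (\<exists>k>0. (T ^^ k) x = x)"

definition period :: "('a \<Rightarrow> 'a) \<Rightarrow> 'a \<Rightarrow> nat" where
  "period T x = (LEAST k. k > 0 \<and> (T ^^ k) x = x)"

definition orbit_measure :: "('a::topological_space \<Rightarrow> 'a) \<Rightarrow> 'a \<Rightarrow> 'a measure" where
  "orbit_measure T x = measure_of UNIV (sets borel)
     (\<lambda>A. (\<Sum>i<period T x. emeasure (return borel ((T ^^ i) x)) A) / of_nat (period T x))"

text \<open>\<open>measure_of\<close> silently returns the zero measure on set functions that are not measures; the following lemmas rule this out.\<close>

lemma sets_orbit_measure [simp]: "sets (orbit_measure T x) = sets borel"
  unfolding orbit_measure_def using sets.sigma_sets_eq[of "borel :: 'a measure"] by simp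

lemma emeasure_orbit_measure:
  assumes "A \<in> sets borel"
  shows "emeasure (orbit_measure T x) A =
    (\<Sum>i<period T x. emeasure (return borel ((T ^^ i) x)) A) / of_nat (period T x)"
proof (rule emeasure_measure_of[OF orbit_measure_def])
  let ?\<mu> = "\<lambda>A. (\<Sum>i<period T x. emeasure (return borel ((T ^^ i) x)) A) / of_nat (period T x)"
  show "positive (sets (orbit_measure T x)) ?\<mu>" by (simp add: positive_def)
  show "countably_additive (sets (orbit_measure T x)) ?\<mu>"
  proof (rule countably_additiveI)
    fix A :: "nat \<Rightarrow> 'a set"
    assume A: "range A \<subseteq> sets (orbit_measure T x)" "disjoint_family A"
    have "(\<Sum>n. emeasure (return borel y) (A n)) = emeasure (return borel y) (\<Union>(range A))" for y
      using A by (intro suminf_emeasure) auto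
    then show "(\<Sum>n. ?\<mu> (A n)) = ?\<mu> (\<Union>(range A))"
      by (simp add: divide_ennreal_def suminf_sum)
  qed
qed (use assms in auto)

definition periodic_measures :: "('a::topological_space \<Rightarrow> 'a) \<Rightarrow> 'a measure set" where
  "periodic_measures T = {orbit_measure T x | x. periodic_point T x}"

text \<open>
  \<open>diam_power s U\<close> is \<open>(diam U)\<^sup>s\<close> with \<open>(diam {})\<^sup>s = 0\<close> and \<open>(diam U)\<^sup>0 = 1\<close> for nonempty \<open>U\<close>;
  the case distinction is needed because \<open>0 powr 0 = 0\<close>.
\<close>

definition diam_power :: "real \<Rightarrow> 'a::metric_space set \<Rightarrow> ennreal" where
  "diam_power s U = (if U = {} then 0 else if s = 0 then 1 else ennreal (diameter U powr s))"

text \<open>Boundedness is required since \<open>diameter\<close> is unspecified on unbounded sets.\<close>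

definition hausdorff_premeasure :: "real \<Rightarrow> real \<Rightarrow> 'a::metric_space set \<Rightarrow> ennreal" where
  "hausdorff_premeasure \<delta> s E =
     (INF U \<in> {U :: nat \<Rightarrow> 'a set. E \<subseteq> (\<Union>i. U i) \<and> (\<forall>i. bounded (U i) \<and> diameter (U i) \<le> \<delta>)}.
        \<Sum>i. diam_power s (U i))"

definition hausdorff_measure :: "real \<Rightarrow> 'a::metric_space set \<Rightarrow> ennreal" where
  "hausdorff_measure s E = (SUP \<delta> \<in> {0<..}. hausdorff_premeasure \<delta> s E)"

definition hausdorff_dim :: "'a::metric_space set \<Rightarrow> ennreal" where
  "hausdorff_dim E = Inf {ennreal s | s. 0 \<le> s \<and> hausdorff_measure s E = 0}"

definition upper_hausdorff_dim :: "'a::metric_space measure \<Rightarrow> ennreal" where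
  "upper_hausdorff_dim \<mu> = (INF E \<in> {E \<in> sets borel. emeasure \<mu> (UNIV - E) = 0}. hausdorff_dim E)"

definition residual_in :: "'a topology \<Rightarrow> 'a set \<Rightarrow> bool" where
  "residual_in X S \<longleftrightarrow> S \<subseteq> topspace X \<and>
     (\<exists>\<G>. countable \<G> \<and> (\<forall>U\<in>\<G>. openin X U \<and> X closure_of U = topspace X) \<and>
          topspace X \<inter> \<Inter>\<G> \<subseteq> S)"

end

theory Submission
  imports Defs "HOL-Real_Asymp.Real_Asymp"
begin

text \<open>
  To every finite set \<open>A\<close> and every \<open>m\<close> assign a radius so small that the balls of that radius around
  the points of \<open>A\<close> contribute at most \<open>(1/2)^m\<close> to the \<open>s\<close>-dimensional Hausdorff measure for all
  \<open>s \<ge> 1/(m+1)\<close>. The invariant measures giving mass more than \<open>1 - (1/2)^m\<close> to such a neighbourhood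
  of some periodic orbit contain an open set (defined through the integral of a bump function) that
  contains all periodic measures, hence is dense. A measure that lies in all these open sets is
  carried by the limit superior of a sequence of such neighbourhoods, which has dimension zero.
\<close>

text \<open>For nonempty finite \<open>A\<close> this is the solution \<open>r\<close> of
  \<open>card A * (2 * r) powr (1 / (m + 1)) = (1/2) ^ m\<close>; here \<open>2 * r\<close> bounds
  the diameter of a ball of radius \<open>r\<close>.\<close>

definition small_radius :: "nat \<Rightarrow> 'a set \<Rightarrow> real" where
  "small_radius m A = ((1/2) ^ m / real (card A)) ^ Suc m / 2"

definition small_nbhd :: "nat \<Rightarrow> 'a::metric_space set \<Rightarrow> 'a set" where
  "small_nbhd m A = (\<Union>a\<in>A. ball a (small_radius m A))"

text \<open>The weak topology tests measures against continuous functions only, so this continuous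
  minorant stands in for the indicator of \<open>small_nbhd m A\<close>. For nonempty finite
  \<open>A\<close> it equals 1 on \<open>A\<close>.\<close>

definition bump :: "nat \<Rightarrow> 'a::metric_space set \<Rightarrow> 'a \<Rightarrow> real" where
  "bump m A y = max 0 (1 - infdist y A / small_radius m A)"

lemma small_radius_pos:
  assumes "finite A" "A \<noteq> {}"
  shows "small_radius m A > 0"
  using assms by (simp add: small_radius_def card_gt_0_iff)

lemma small_radius_le:
  assumes "finite A" "A \<noteq> {}"
  shows "2 * small_radius m A \<le> (1/2) ^ m"
proof -
  let ?q = "(1/2) ^ m / real (card A)"
  have card: "real (card A) \<ge> 1"
    using assms by (simp add: card_gt_0_iff Suc_leI)
  have le: "?q \<le> (1/2) ^ m"
    using card by (simp add: field_simps)
  also have "(1/2::real) ^ m \<le> 1"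
    by (simp add: power_le_one)
  finally have "?q ^ Suc m \<le> ?q ^ 1"
    by (intro power_decreasing) auto
  with le show ?thesis
    unfolding small_radius_def by simp
qed

text \<open>With \<open>q = (1/2) ^ m / card A\<close>, the power is
  \<open>q powr (s * (m + 1))\<close>. Since \<open>q\<close> \<le> 1 and the exponent is at least
  1, this is at most \<open>q\<close>, and the factor \<open>card A\<close> cancels.\<close>

lemma card_mult_small_radius_powr_le:
  assumes "finite A" "A \<noteq> {}" and s: "1 \<le> s * real (Suc m)"
  shows "real (card A) * (2 * small_radius m A) powr s \<le> (1/2) ^ m"
proof -
  let ?q = "(1/2) ^ m / real (card A)"
  have card: "real (card A) \<ge> 1"
    using assms by (simp add: card_gt_0_iff Suc_leI)
  have pos: "?q > 0"
    using card by (intro divide_pos_pos) auto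
  have "?q \<le> (1/2) ^ m"
    using card by (simp add: field_simps)
  also have "(1/2::real) ^ m \<le> 1"
    by (simp add: power_le_one)
  finally have q1: "?q \<le> 1" .
  have "(2 * small_radius m A) powr s = (?q powr real (Suc m)) powr s"
    using pos unfolding small_radius_def by (subst powr_realpow) simp_all
  also have "\<dots> = ?q powr (s * real (Suc m))"
    by (simp add: powr_powr mult.commute)
  also have "\<dots> \<le> ?q powr 1"
    using pos q1 s by (intro powr_mono') auto
  also have "\<dots> = ?q"
    using pos by simp
  finally show ?thesis
    using card by (simp add: field_simps)
qed

lemma borel_small_nbhd [measurable]: "small_nbhd m A \<in> sets borel"
  unfolding small_nbhd_def by (intro borel_open open_UN ballI open_ball)

lemma continuous_bump: "continuous_on UNIV (bump m A)"
  unfolding bump_def divide_inverse by (intro continuous_intros)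

lemma bump_bounds:
  assumes "finite A" "A \<noteq> {}"
  shows "0 \<le> bump m A y" "bump m A y \<le> indicator (small_nbhd m A) y"
proof -
  have r: "small_radius m A > 0"
    by (rule small_radius_pos[OF assms])
  show "0 \<le> bump m A y"
    by (simp add: bump_def)
  show "bump m A y \<le> indicator (small_nbhd m A) y"
  proof (cases "y \<in> small_nbhd m A")
    case True
    then show ?thesis
      using r by (simp add: bump_def infdist_nonneg)
  next
    case False
    \<comment> \<open>Nonemptiness matters: the distance to the empty set is 0 by convention, which
      would make the bump constantly 1.\<close>
    have "small_radius m A \<le> infdist y A"
      using assms(2) False
      by (auto simp: infdist_notempty small_nbhd_def dist_commute not_less intro!: cINF_greatest)
    then show ?thesis
      using r False by (simp add: bump_def field_simps)
  qed
qed

lemma bounded_bump: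
  assumes "finite A" "A \<noteq> {}"
  shows "bounded (range (bump m A))"
proof -
  have "bump m A y \<le> 1" for y
    using bump_bounds(2)[OF assms, of m y] by (auto intro: order_trans simp: indicator_def split: if_splits)
  then show ?thesis
    using bump_bounds(1)[OF assms] by (intro boundedI[of _ 1]) auto
qed

text \<open>All balls of all stages from \<open>N\<close> on form the cover. Stage
  \<open>m + N\<close> costs at most \<open>(1/2) ^ (m + N)\<close>, and the geometric series sums
  to the bound. The conditions on \<open>s\<close> and \<delta> at stage \<open>N\<close> pass to
  all later stages.\<close>

lemma hausdorff_premeasure_limsup_le:
  fixes A :: "nat \<Rightarrow> 'a::metric_space set"
  assumes A: "\<And>m. finite (A m)" "\<And>m. A m \<noteq> {}"
    and E: "E \<subseteq> (\<Union>m. small_nbhd (m + N) (A (m + N)))"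
    and s: "s > 0" "1 \<le> s * real (Suc N)" and \<delta>: "(1/2) ^ N \<le> \<delta>"
  shows "hausdorff_premeasure \<delta> s E \<le> ennreal (2 * (1/2) ^ N)"
proof -
  have "\<exists>g. bij_betw g {0..<card (A m)} (A m)" for m
    using ex_bij_betw_nat_finite[OF A(1)] .
  then obtain g where g: "\<And>m. bij_betw (g m) {0..<card (A m)} (A m)"
    by metis
  let ?r = "\<lambda>m. small_radius (m + N) (A (m + N))"
  let ?k = "\<lambda>m. card (A (m + N))"
  \<comment> \<open>Padding by empty sets, which cost 0 in \<open>diam_power\<close>, makes every
    stage an infinite sequence.\<close>
  define V where "V p = (case p of (m, i) \<Rightarrow> if i < ?k m then ball (g (m + N) i) (?r m) else {})" for p
  have r_pos: "?r m > 0" for m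
    by (rule small_radius_pos[OF A])
  have diam: "diameter (V (m, i)) \<le> 2 * ?r m" for m i
  proof (cases "V (m, i) = {}")
    case True
    then show ?thesis
      using r_pos[of m] by simp
  next
    case False
    have "dist x y \<le> 2 * ?r m" if "x \<in> V (m, i)" "y \<in> V (m, i)" for x y
      using that dist_triangle3[of x y "g (m + N) i"]
      by (auto simp: V_def split: if_splits)
    with False show ?thesis
      unfolding diameter_def by (auto intro!: cSUP_least)
  qed
  have bdd: "bounded (V p)" for p
    by (simp add: V_def split: prod.split)
  \<comment> \<open>The pairing function flattens the double family into the single sequence that
    \<open>hausdorff_premeasure\<close> asks for; the nonnegative costs are later regrouped by
    stage.\<close>
  have "E \<subseteq> (\<Union>n. V (prod_decode n))"
  proof
    fix x assume "x \<in> E"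
    with E obtain m a where a: "a \<in> A (m + N)" "x \<in> ball a (?r m)"
      by (auto simp: small_nbhd_def)
    then have "a \<in> g (m + N) ` {0..<?k m}"
      using g[of "m + N"] by (simp add: bij_betw_def)
    then obtain i where "i < ?k m" "a = g (m + N) i"
      by auto
    with a have "x \<in> V (prod_decode (prod_encode (m, i)))"
      by (simp add: V_def)
    then show "x \<in> (\<Union>n. V (prod_decode n))"
      by blast
  qed
  moreover have "diameter (V p) \<le> \<delta>" for p
  proof (cases p)
    case (Pair m i)
    have "diameter (V p) \<le> 2 * ?r m"
      using diam Pair by simp
    also have "\<dots> \<le> (1/2) ^ (m + N)"
      by (rule small_radius_le[OF A])
    also have "\<dots> \<le> (1/2) ^ N"
      by (intro power_decreasing) auto
    finally show ?thesis
      using \<delta> by simp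
  qed
  ultimately have "hausdorff_premeasure \<delta> s E \<le> (\<Sum>n. diam_power s (V (prod_decode n)))"
    unfolding hausdorff_premeasure_def using bdd by (intro INF_lower) auto
  also have "\<dots> = (\<Sum>m. \<Sum>i. diam_power s (V (m, i)))"
    by (rule suminf_ennreal_2dimen) simp
  also have "\<dots> \<le> (\<Sum>m. ennreal ((1/2) ^ N * (1/2) ^ m))"
  proof (intro suminf_le summableI)
    fix m
    have "(\<Sum>i. diam_power s (V (m, i))) = (\<Sum>i<?k m. diam_power s (V (m, i)))"
      by (rule suminf_finite) (auto simp: V_def diam_power_def)
    also have "\<dots> \<le> (\<Sum>i<?k m. ennreal ((2 * ?r m) powr s))"
      using diam[of m] s bdd[of "(m, _)"]
      by (intro sum_mono) (auto simp: diam_power_def intro!: ennreal_leI powr_mono2 diameter_ge_0)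
    also have "\<dots> = ennreal (real (?k m) * (2 * ?r m) powr s)"
      by (simp add: ennreal_mult ennreal_of_nat_eq_real_of_nat)
    also have "\<dots> \<le> ennreal ((1/2) ^ (m + N))"
    proof (intro ennreal_leI card_mult_small_radius_powr_le A)
      have "s * real (Suc N) \<le> s * real (Suc (m + N))"
        using s by (intro mult_left_mono) auto
      with s show "1 \<le> s * real (Suc (m + N))"
        by linarith
    qed
    finally show "(\<Sum>i. diam_power s (V (m, i))) \<le> ennreal ((1/2) ^ N * (1/2) ^ m)"
      by (simp add: power_add mult.commute)
  qed
  also have "\<dots> = ennreal (\<Sum>m. (1/2) ^ N * (1/2) ^ m)"
    by (intro suminf_ennreal2 summable_mult summable_geometric) auto
  also have "(\<Sum>m. (1/2) ^ N * (1/2::real) ^ m) = 2 * (1/2) ^ N"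
    by (subst suminf_mult) (auto simp: suminf_geometric)
  finally show ?thesis .
qed

text \<open>Each \<open>e > 0\<close> is itself a competitor in the infimum, which is therefore at
  most \<open>e\<close>.\<close>

lemma hausdorff_dim_eq_0I:
  assumes "\<And>s. s > 0 \<Longrightarrow> hausdorff_measure s E = 0"
  shows "hausdorff_dim E = 0"
proof -
  have "hausdorff_dim E \<le> 0"
  proof (rule ennreal_le_epsilon)
    fix e :: real assume "0 < e"
    then show "hausdorff_dim E \<le> 0 + ennreal e"
      unfolding hausdorff_dim_def using assms[of e] by (auto intro!: Inf_lower)
  qed
  then show ?thesis by simp
qed

text \<open>The intersection lies in every tail union, so for fixed \<open>s\<close> and \<delta>
  the bound of \<open>hausdorff_premeasure_limsup_le\<close> applies for all large \<open>n\<close>,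
  and it tends to 0.\<close>

lemma hausdorff_dim_limsup_small_nbhd:
  fixes A :: "nat \<Rightarrow> 'a::metric_space set"
  assumes A: "\<And>m. finite (A m)" "\<And>m. A m \<noteq> {}"
  shows "hausdorff_dim (\<Inter>n. \<Union>m. small_nbhd (m + n) (A (m + n))) = 0"
    (is "hausdorff_dim ?E = 0")
proof (rule hausdorff_dim_eq_0I)
  fix s :: real assume s: "s > 0"
  have "hausdorff_premeasure \<delta> s ?E \<le> 0" if \<delta>: "\<delta> > 0" for \<delta>
  proof (rule tendsto_lowerbound)
    have lim: "(\<lambda>n. (1/2::real) ^ n) \<longlonglongrightarrow> 0"
      by (intro LIMSEQ_power_zero) simp
    show "(\<lambda>n. ennreal (2 * (1/2) ^ n)) \<longlonglongrightarrow> 0"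
      using tendsto_ennrealI[OF tendsto_mult_left[OF lim, of 2]] by simp
    have "\<forall>\<^sub>F n in sequentially. (1/2) ^ n < \<delta>"
      using lim \<delta> by (rule order_tendstoD)
    moreover have "\<forall>\<^sub>F n in sequentially. 1 \<le> s * real (Suc n)"
      using s by real_asymp
    ultimately show "\<forall>\<^sub>F n in sequentially. hausdorff_premeasure \<delta> s ?E \<le> ennreal (2 * (1/2) ^ n)"
    proof eventually_elim
      case (elim n)
      then show ?case
        using s by (intro hausdorff_premeasure_limsup_le[OF A]) auto
    qed
  qed simp
  then show "hausdorff_measure s ?E = 0"
    unfolding hausdorff_measure_def by (auto intro!: antisym SUP_least)
qed

text \<open>The bump integrals bound the masses of the neighbourhoods from below. Every tail union
  then has full mass, and so does the countable intersection of the tails, a Borel set of dimension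
  0.\<close>

lemma upper_hausdorff_dim_eq_0I:
  fixes \<mu> :: "'a::metric_space measure"
  assumes "prob_space \<mu>" and [measurable_cong]: "sets \<mu> = sets borel"
    and A: "\<And>m. finite (A m)" "\<And>m. A m \<noteq> {}"
    and bump: "\<And>m. 1 - (1/2) ^ m < integral\<^sup>L \<mu> (bump m (A m))"
  shows "upper_hausdorff_dim \<mu> = 0"
proof -
  interpret prob_space \<mu> by fact
  have space: "space \<mu> = UNIV"
    using sets_eq_imp_space_eq[OF assms(2)] by simp
  let ?N = "\<lambda>m. small_nbhd m (A m)"
  let ?E = "\<Inter>n. \<Union>m. ?N (m + n)"
  have [measurable]: "?N m \<in> sets \<mu>" for m
    using borel_small_nbhd assms(2) by blast
  have mass: "1 - (1/2) ^ m < measure \<mu> (?N m)" for m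
  proof -
    have "integral\<^sup>L \<mu> (bump m (A m)) \<le> integral\<^sup>L \<mu> (indicator (?N m))"
      by (intro integral_mono' bump_bounds[OF A]) (simp_all add: less_top[symmetric])
    also have "\<dots> = measure \<mu> (?N m)"
      by simp
    finally show ?thesis
      using bump[of m] by linarith
  qed
  have tail: "AE x in \<mu>. x \<in> (\<Union>m. ?N (m + n))" for n
  proof -
    \<comment> \<open>A tail union contains neighbourhoods of mass arbitrarily close to 1, so its
      own mass is 1.\<close>
    have "1 - (1/2) ^ (m + n) \<le> measure \<mu> (\<Union>m. ?N (m + n))" for m
    proof -
      have "measure \<mu> (?N (m + n)) \<le> measure \<mu> (\<Union>m. ?N (m + n))"
        by (intro finite_measure_mono) auto
      with mass[of "m + n"] show ?thesis by linarith
    qed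
    moreover have "(\<lambda>m. 1 - (1/2::real) ^ (m + n)) \<longlonglongrightarrow> 1"
      by real_asymp
    ultimately have "1 \<le> measure \<mu> (\<Union>m. ?N (m + n))"
      by (intro LIMSEQ_le_const2) auto
    then show ?thesis
      using prob_le_1 by (intro AE_prob_1 antisym) auto
  qed
  have "AE x in \<mu>. x \<in> ?E"
    using tail by (auto simp: AE_all_countable)
  moreover have "UNIV - ?E \<in> sets \<mu>"
    using assms(2) by measurable
  ultimately have "emeasure \<mu> (UNIV - ?E) = 0"
    by (subst AE_iff_measurable[symmetric, OF _ _, where P = "\<lambda>x. x \<in> ?E"]) (auto simp: space)
  moreover have "?E \<in> sets borel"
    by measurable
  ultimately have "upper_hausdorff_dim \<mu> \<le> hausdorff_dim ?E"
    unfolding upper_hausdorff_dim_def by (intro INF_lower) auto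
  then show ?thesis
    using hausdorff_dim_limsup_small_nbhd[of A, OF A] by simp
qed

definition orbit :: "('a \<Rightarrow> 'a) \<Rightarrow> 'a \<Rightarrow> 'a set" where
  "orbit T x = (\<lambda>i. (T ^^ i) x) ` {..<period T x}"

text \<open>For a periodic point the \<open>LEAST\<close> in \<open>period\<close> is attained, so
  the period is positive and the index 0 occurs.\<close>

lemma orbit_nonempty: "periodic_point T x \<Longrightarrow> orbit T x \<noteq> {}"
  using LeastI_ex[of "\<lambda>k. k > 0 \<and> (T ^^ k) x = x"]
  by (auto simp: periodic_point_def orbit_def period_def)

lemma finite_orbit: "finite (orbit T x)"
  by (simp add: orbit_def)

text \<open>No mass lies off the orbit, and the bump is 1 on it. Total mass 1 is assumed here; in
  the application it comes from membership in \<open>invariant_prob_measures T\<close>.\<close>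

lemma integral_bump_orbit_measure:
  assumes "prob_space (orbit_measure T x)"
  shows "integral\<^sup>L (orbit_measure T x) (bump m (orbit T x)) = 1"
proof -
  interpret prob_space "orbit_measure T x" by fact
  have space: "space (orbit_measure T x) = UNIV"
    using sets_eq_imp_space_eq[OF sets_orbit_measure] by simp
  have O: "- orbit T x \<in> sets borel"
    by (intro borel_open open_Compl finite_imp_closed finite_orbit)
  \<comment> \<open>Each point mass in the average sits on the orbit, so every summand
    vanishes.\<close>
  then have "emeasure (orbit_measure T x) (- orbit T x) = 0"
    by (subst emeasure_orbit_measure) (auto simp: orbit_def)
  then have "AE y in orbit_measure T x. y \<in> orbit T x"
    using O by (intro AE_I[of _ _ "- orbit T x"]) auto
  then have "AE y in orbit_measure T x. bump m (orbit T x) y = 1"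
    by eventually_elim (simp add: bump_def)
  then have "integral\<^sup>L (orbit_measure T x) (bump m (orbit T x)) = integral\<^sup>L (orbit_measure T x) (\<lambda>_. 1)"
    by (intro integral_cong_AE) (auto intro!: borel_measurable_continuous_onI continuous_bump cong: measurable_cong_sets)
  then show ?thesis
    using prob_space by simp
qed

theorem corollary1p1:
  fixes T :: "'a::metric_space \<Rightarrow> 'a"
  assumes "compact (UNIV :: 'a set)"
    and "continuous_on UNIV T"
    and "weak_topology_on (invariant_prob_measures T) closure_of periodic_measures T =
         invariant_prob_measures T"
  shows "residual_in (weak_topology_on (invariant_prob_measures T))
           {\<mu> \<in> invariant_prob_measures T. upper_hausdorff_dim \<mu> = 0}"
proof -
  let ?M = "invariant_prob_measures T"
  let ?W = "weak_topology_on ?M"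
  \<comment> \<open>The threshold is below 1, the value attained at periodic measures, and the
    strict inequality makes each set of the union open. The orbit may depend on the measure and on
    \<open>m\<close>.\<close>
  define G where "G m = (\<Union>x\<in>Collect (periodic_point T).
      {\<mu> \<in> ?M. integral\<^sup>L \<mu> (bump m (orbit T x)) \<in> {1 - (1/2) ^ m<..}})" for m
  have "openin ?W (G m)" for m
    unfolding G_def
  proof (intro openin_Union ballI, clarify)
    fix x assume "periodic_point T x"
    then have "bounded (range (bump m (orbit T x)))"
      by (intro bounded_bump finite_orbit orbit_nonempty)
    then show "openin ?W {\<mu> \<in> ?M. integral\<^sup>L \<mu> (bump m (orbit T x)) \<in> {1 - (1/2) ^ m<..}}"
      unfolding weak_topology_on_def
      using continuous_bump[of m "orbit T x"] open_greaterThan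
      by (intro topology_generated_by_Basis CollectI exI[of _ "bump m (orbit T x)"] exI[of _ "{1 - (1/2) ^ m<..}"]) blast
  qed
  moreover have "?W closure_of G m = ?M" for m
  proof -
    \<comment> \<open>It suffices to treat the periodic measures inside \<open>?M\<close>: a closure
      in \<open>?W\<close> depends only on the part of a set inside the topspace, by
      \<open>closure_of_restrict\<close>.\<close>
    have "?M \<inter> periodic_measures T \<subseteq> G m"
    proof
      fix \<mu> assume \<mu>: "\<mu> \<in> ?M \<inter> periodic_measures T"
      then obtain x where x: "periodic_point T x" "\<mu> = orbit_measure T x"
        by (auto simp: periodic_measures_def)
      with \<mu> have "integral\<^sup>L \<mu> (bump m (orbit T x)) = 1"
        by (auto simp: invariant_prob_measures_def intro!: integral_bump_orbit_measure)
      with \<mu> x show "\<mu> \<in> G m"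
        by (auto simp: G_def)
    qed
    then have "?W closure_of (?M \<inter> periodic_measures T) \<subseteq> ?W closure_of G m"
      by (rule closure_of_mono)
    then have "?M \<subseteq> ?W closure_of G m"
      using assms(3) closure_of_restrict[of ?W "periodic_measures T"] by simp
    then show ?thesis
      using closure_of_subset_topspace[of ?W "G m"] by auto
  qed
  moreover have "upper_hausdorff_dim \<mu> = 0" if \<mu>: "\<mu> \<in> ?M" "\<And>m. \<mu> \<in> G m" for \<mu>
  proof -
    \<comment> \<open>One orbit is chosen for each \<open>m\<close>; these finite sets form the
      sequence \<open>A\<close> of \<open>upper_hausdorff_dim_eq_0I\<close>.\<close>
    have "\<exists>x. periodic_point T x \<and> 1 - (1/2) ^ m < integral\<^sup>L \<mu> (bump m (orbit T x))" for m
      using \<mu>(2)[of m] by (auto simp: G_def)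
    then obtain x where x: "\<And>m. periodic_point T (x m)"
      "\<And>m. 1 - (1/2) ^ m < integral\<^sup>L \<mu> (bump m (orbit T (x m)))"
      by metis
    show ?thesis
    proof (rule upper_hausdorff_dim_eq_0I[where A = "\<lambda>m. orbit T (x m)"])
      show "prob_space \<mu>" "sets \<mu> = sets borel"
        using \<mu>(1) by (auto simp: invariant_prob_measures_def)
    qed (use x in \<open>auto intro: finite_orbit dest: orbit_nonempty\<close>)
  qed
  ultimately show ?thesis
    unfolding residual_in_def by (intro conjI exI[of _ "range G"]) auto
qed

end
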